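(* Let $(\mathcal{E}_n,\mathcal{H}_n,D_n)$ ($n=1,2,\ldots$) and $(\mathcal{E},\mathcal{H},D)$ be operator system spectral triples, with associated operator systems $E_n\supseteq\mathcal{E}_n$ and $E\supseteq \mathcal{E}$, such that the distance functions $d_{E_n}$ on $\mathcal{S}(E_n)$ and $d_E$ on $\mathcal{S}(E)$ are metrics whose topologies agree with the weak-$*$ topologies on $\mathcal{S}(E_n)$ and $\mathcal{S}(E)$, respectively. If there is a $C^1$-approximate order isomorphism $(R_n,S_n)$ for $\{(\mathcal{E}_n,\mathcal{H}_n,D_n)\}_n$ and $(\mathcal{E},\mathcal{H},D)$, then the metric spaces $(\mathcal{S}(E_n),d_{E_n})$ converge to $(\mathcal{S}(E),d_E)$ in Gromov--Hausdorff distance as $n\to\infty$.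
   Context: An operator system $E$ is a $*$-closed linear subspace of $\mathcal{B}(\mathcal{H})$ ($\mathcal{H}$ a Hilbert space) containing the identity; it inherits the operator norm and the order (positive elements) of $\mathcal{B}(\mathcal{H})$. Its state space $\mathcal{S}(E)$ is the set of positive linear functionals on $E$ of norm $1$. An operator system spectral triple is a triple $(\mathcal{E},\mathcal{H},D)$ where $\mathcal{E}$ is a dense subspace of an operator system $E\subseteq\mathcal{B}(\mathcal{H})$, $\mathcal{H}$ is a Hilbert space, and $D$ is a self-adjoint operator in $\mathcal{H}$ with compact resolvent such that $[D,T]$ is a bounded operator for all $T\in\mathcal{E}$. The Lipschitz semi-norm on $\mathcal{E}$ is $\|x\|_1=\|[D,x]\|$ (operator norm), and the (generalized) distance on $\mathcal{S}(E)$ is $$d_E(\phi,\psi)=\sup\{|\phi(x)-\psi(x)| : x\in\mathcal{E},\ \|x\|_1\le 1\}.$$ The distance $d_{E_n}$ on $\mathcal{S}(E_n)$ is defined in the same way from $(\mathcal{E}_n,\mathcal{H}_n,D_n)$. An approximate order isomorphism for $\{(\mathcal{E}_n,\mathcal{H}_n,D_n)\}_n$ and $(\mathcal{E},\mathcal{H},D)$ is given by linear maps $R_n:E\to E_n$ and $S_n:E_n\to E$ for every $n$ such that: (1) all $R_n,S_n$ are positive and unital; (2) there are sequences $\gamma_n,\gamma_n'$ (of nonnegative reals) both converging to $0$ with $\|S_n\circ R_n(a)-a\|\le\gamma_n\|a\|_1$ for all $a\in\mathcal{E}$ and $\|R_n\circ S_n(h)-h\|\le\gamma_n'\|h\|_1$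 for all $h\in\mathcal{E}_n$. It is a $C^1$-approximate order isomorphism if moreover all maps $R_n$ and $S_n$ are $C^1$-contractive, i.e. contractive for the operator norms and for the Lipschitz semi-norms: $R_n(\mathcal{E})\subseteq\mathcal{E}_n$, $S_n(\mathcal{E}_n)\subseteq\mathcal{E}$, $\|R_n(a)\|_1\le\|a\|_1$ for $a\in\mathcal{E}$, and $\|S_n(h)\|_1\le\|h\|_1$ for $h\in\mathcal{E}_n$. *)

theory Defs
  imports "HOL-Analysis.Analysis" "HOL-Algebra.Module"
begin

section \<open>Complex Hilbert spaces with explicit carriers\<close>

text \<open>
  To allow sequences of different Hilbert spaces, a Hilbert space is a record value
  with a carrier set rather than a type. The complex numbers are one record that serves both as the
  scalar ring and as the target module of functionals.
\<close>

definition complex_module :: "(complex, complex) module" where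
  "complex_module =
     \<lparr>carrier = UNIV, monoid.mult = (*), one = 1, zero = 0, add = (+), smult = (*)\<rparr>"

record 'h inner_space = "(complex, 'h) module" +
  cinner :: "'h \<Rightarrow> 'h \<Rightarrow> complex"

definition hnorm :: "'h inner_space \<Rightarrow> 'h \<Rightarrow> real" where
  "hnorm H x = sqrt (Re (cinner H x x))"

text \<open>
  The locale \<open>Metric_space\<close> asks for symmetry and nonnegativity on the whole type, hence the value 0
  off the carrier.
\<close>

definition hdist :: "'h inner_space \<Rightarrow> 'h \<Rightarrow> 'h \<Rightarrow> real" where
  "hdist H x y =
     (if x \<in> carrier H \<and> y \<in> carrier H then hnorm H (x \<ominus>\<^bsub>H\<^esub> y) else 0)"

definition htopology :: "'h inner_space \<Rightarrow> 'h topology" where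
  "htopology H = Metric_space.mtopology (carrier H) (hdist H)"

text \<open>The inner product is linear in its second argument.\<close>

locale hilbert_space = module complex_module H for H :: "'h inner_space" (structure) +
  assumes cinner_add: "\<lbrakk>x \<in> carrier H; y \<in> carrier H; z \<in> carrier H\<rbrakk>
      \<Longrightarrow> cinner H x (y \<oplus> z) = cinner H x y + cinner H x z"
    and cinner_smult: "\<lbrakk>x \<in> carrier H; y \<in> carrier H\<rbrakk>
      \<Longrightarrow> cinner H x (c \<odot> y) = c * cinner H x y"
    and cinner_commute: "\<lbrakk>x \<in> carrier H; y \<in> carrier H\<rbrakk>
      \<Longrightarrow> cinner H y x = cnj (cinner H x y)"
    and cinner_pos: "\<lbrakk>x \<in> carrier H; x \<noteq> \<zero>\<rbrakk> \<Longrightarrow> 0 < Re (cinner H x x)"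
    and mcomplete: "Metric_space.mcomplete (carrier H) (hdist H)"


section \<open>Operators\<close>

text \<open>
  Linear maps are extensional, that is, undefined outside the carrier of the domain. Thus equality
  in HOL is equality of maps.
\<close>

definition linear_maps ::
    "(complex, 'a, 'm) module_scheme \<Rightarrow> (complex, 'b, 'n) module_scheme \<Rightarrow> ('a \<Rightarrow> 'b) set" where
  "linear_maps M N = {f \<in> carrier M \<rightarrow>\<^sub>E carrier N.
     (\<forall>x\<in>carrier M. \<forall>y\<in>carrier M. f (x \<oplus>\<^bsub>M\<^esub> y) = f x \<oplus>\<^bsub>N\<^esub> f y) \<and>
     (\<forall>c. \<forall>x\<in>carrier M. f (c \<odot>\<^bsub>M\<^esub> x) = c \<odot>\<^bsub>N\<^esub> f x)}"

text \<open>Norm, with values in \<open>[0,\<infinity>]\<close>, of an operator in \<open>H\<close> with domain \<open>V\<close>.\<close>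

definition opnorm_on :: "'h inner_space \<Rightarrow> 'h set \<Rightarrow> ('h \<Rightarrow> 'h) \<Rightarrow> ennreal" where
  "opnorm_on H V T = (SUP x\<in>{x \<in> V. hnorm H x \<le> 1}. ennreal (hnorm H (T x)))"

abbreviation opnorm :: "'h inner_space \<Rightarrow> ('h \<Rightarrow> 'h) \<Rightarrow> ennreal" where
  "opnorm H \<equiv> opnorm_on H (carrier H)"

definition opdist :: "'h inner_space \<Rightarrow> ('h \<Rightarrow> 'h) \<Rightarrow> ('h \<Rightarrow> 'h) \<Rightarrow> ennreal" where
  "opdist H S T = opnorm H (\<lambda>x. S x \<ominus>\<^bsub>H\<^esub> T x)"

definition identity_op :: "'h inner_space \<Rightarrow> 'h \<Rightarrow> 'h" where
  "identity_op H = (\<lambda>x\<in>carrier H. x)"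

definition bounded_operators :: "'h inner_space \<Rightarrow> (complex, 'h \<Rightarrow> 'h) module" where
  "bounded_operators H =
     \<lparr>carrier = {T \<in> linear_maps H H. opnorm H T < \<infinity>},
      monoid.mult = compose (carrier H),
      one = identity_op H,
      zero = (\<lambda>x\<in>carrier H. \<zero>\<^bsub>H\<^esub>),
      add = (\<lambda>S T. \<lambda>x\<in>carrier H. S x \<oplus>\<^bsub>H\<^esub> T x),
      smult = (\<lambda>c T. \<lambda>x\<in>carrier H. c \<odot>\<^bsub>H\<^esub> T x)\<rparr>"

text \<open>Graph of the adjoint of an operator \<open>T\<close> with domain \<open>V\<close>.\<close>

definition adjoint_graph :: "'h inner_space \<Rightarrow> 'h set \<Rightarrow> ('h \<Rightarrow> 'h) \<Rightarrow> ('h \<times> 'h) set" where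
  "adjoint_graph H V T = {(y, z). y \<in> carrier H \<and> z \<in> carrier H \<and>
     (\<forall>x\<in>V. cinner H y (T x) = cinner H z x)}"

definition self_adjoint_on :: "'h inner_space \<Rightarrow> 'h set \<Rightarrow> ('h \<Rightarrow> 'h) \<Rightarrow> bool" where
  "self_adjoint_on H V D \<longleftrightarrow>
     submodule V complex_module H \<and> D \<in> linear_maps (H\<lparr>carrier := V\<rparr>) H \<and>
     htopology H closure_of V = carrier H \<and>
     adjoint_graph H V D = {(x, D x) | x. x \<in> V}"

definition compact_operator :: "'h inner_space \<Rightarrow> ('h \<Rightarrow> 'h) \<Rightarrow> bool" where
  "compact_operator H K \<longleftrightarrow> K \<in> carrier (bounded_operators H) \<and>
     compactin (htopology H) (htopology H closure_of (K ` {x \<in> carrier H. hnorm H x \<le> 1}))"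

text \<open>\<open>K\<close> is the bounded inverse of \<open>D - \<mu>\<close>; in particular \<open>\<mu>\<close> is in the resolvent set of \<open>D\<close>.\<close>

definition is_resolvent ::
    "'h inner_space \<Rightarrow> 'h set \<Rightarrow> ('h \<Rightarrow> 'h) \<Rightarrow> complex \<Rightarrow> ('h \<Rightarrow> 'h) \<Rightarrow> bool" where
  "is_resolvent H V D \<mu> K \<longleftrightarrow> K \<in> carrier (bounded_operators H) \<and>
     (\<forall>x\<in>V. K (D x \<ominus>\<^bsub>H\<^esub> \<mu> \<odot>\<^bsub>H\<^esub> x) = x) \<and>
     (\<forall>y\<in>carrier H. K y \<in> V \<and> D (K y) \<ominus>\<^bsub>H\<^esub> \<mu> \<odot>\<^bsub>H\<^esub> K y = y)"

text \<open>
  By the resolvent identity, compactness of one resolvent is equivalent to compactness of all of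
  them.
\<close>

definition has_compact_resolvent :: "'h inner_space \<Rightarrow> 'h set \<Rightarrow> ('h \<Rightarrow> 'h) \<Rightarrow> bool" where
  "has_compact_resolvent H V D \<longleftrightarrow>
     (\<exists>\<mu> K. is_resolvent H V D \<mu> K \<and> compact_operator H K)"


section \<open>Operator systems and states\<close>

definition operator_system :: "'h inner_space \<Rightarrow> ('h \<Rightarrow> 'h) set \<Rightarrow> bool" where
  "operator_system H E \<longleftrightarrow>
     submodule E complex_module (bounded_operators H) \<and> identity_op H \<in> E \<and>
     (\<forall>T\<in>E. \<exists>T'\<in>E. adjoint_graph H (carrier H) T = {(y, T' y) | y. y \<in> carrier H})"

definition positive_op :: "'h inner_space \<Rightarrow> ('h \<Rightarrow> 'h) \<Rightarrow> bool" where
  "positive_op H T \<longleftrightarrow> (\<forall>x\<in>carrier H. cinner H x (T x) \<in> \<real>\<^sub>\<ge>\<^sub>0)"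

abbreviation opsys_module :: "'h inner_space \<Rightarrow> ('h \<Rightarrow> 'h) set \<Rightarrow> (complex, 'h \<Rightarrow> 'h) module" where
  "opsys_module H E \<equiv> (bounded_operators H)\<lparr>carrier := E\<rparr>"

definition functional_norm ::
    "'h inner_space \<Rightarrow> ('h \<Rightarrow> 'h) set \<Rightarrow> (('h \<Rightarrow> 'h) \<Rightarrow> complex) \<Rightarrow> ennreal" where
  "functional_norm H E \<phi> = (SUP T\<in>{T \<in> E. opnorm H T \<le> 1}. ennreal (cmod (\<phi> T)))"

definition state_space ::
    "'h inner_space \<Rightarrow> ('h \<Rightarrow> 'h) set \<Rightarrow> (('h \<Rightarrow> 'h) \<Rightarrow> complex) set" where
  "state_space H E = {\<phi> \<in> linear_maps (opsys_module H E) complex_module.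
     (\<forall>T\<in>E. positive_op H T \<longrightarrow> \<phi> T \<in> \<real>\<^sub>\<ge>\<^sub>0) \<and> functional_norm H E \<phi> = 1}"

definition weak_star_topology ::
    "'h inner_space \<Rightarrow> ('h \<Rightarrow> 'h) set \<Rightarrow> (('h \<Rightarrow> 'h) \<Rightarrow> complex) topology" where
  "weak_star_topology H E =
     subtopology (product_topology (\<lambda>_. euclidean) E) (state_space H E)"


section \<open>Operator system spectral triples\<close>

text \<open>
  The record holds \<open>\<H>\<close>, the operator system \<open>E\<close>, its dense subspace \<open>\<E>\<close> and the operator \<open>D\<close>
  together with its domain.
\<close>

record 'h spectral_triple =
  hilb :: "'h inner_space"
  opsys :: "('h \<Rightarrow> 'h) set"
  smooth :: "('h \<Rightarrow> 'h) set"
  dirac_dom :: "'h set"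
  dirac :: "'h \<Rightarrow> 'h"

text \<open>
  The norm of the commutator \<open>[D,T]\<close> on its dense domain, which is the norm of its bounded extension
  to \<open>\<H>\<close>.
\<close>

definition lip :: "'h spectral_triple \<Rightarrow> ('h \<Rightarrow> 'h) \<Rightarrow> ennreal" where
  "lip X T = opnorm_on (hilb X) (dirac_dom X)
     (\<lambda>x. dirac X (T x) \<ominus>\<^bsub>hilb X\<^esub> T (dirac X x))"

definition operator_system_spectral_triple :: "'h spectral_triple \<Rightarrow> bool" where
  "operator_system_spectral_triple X \<longleftrightarrow>
     hilbert_space (hilb X) \<and>
     operator_system (hilb X) (opsys X) \<and>
     submodule (smooth X) complex_module (opsys_module (hilb X) (opsys X)) \<and>
     (\<forall>T\<in>opsys X. \<forall>\<epsilon>>0. \<exists>S\<in>smooth X. opdist (hilb X) T S < ennreal \<epsilon>) \<and>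
     self_adjoint_on (hilb X) (dirac_dom X) (dirac X) \<and>
     has_compact_resolvent (hilb X) (dirac_dom X) (dirac X) \<and>
     (\<forall>T\<in>smooth X. T ` dirac_dom X \<subseteq> dirac_dom X \<and> lip X T < \<infinity>)"

abbreviation states :: "'h spectral_triple \<Rightarrow> (('h \<Rightarrow> 'h) \<Rightarrow> complex) set" where
  "states X \<equiv> state_space (hilb X) (opsys X)"

definition state_dist ::
    "'h spectral_triple \<Rightarrow> (('h \<Rightarrow> 'h) \<Rightarrow> complex) \<Rightarrow> (('h \<Rightarrow> 'h) \<Rightarrow> complex) \<Rightarrow> ennreal" where
  "state_dist X \<phi> \<psi> = (SUP T\<in>{T \<in> smooth X. lip X T \<le> 1}. ennreal (cmod (\<phi> T - \<psi> T)))"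

definition state_metric ::
    "'h spectral_triple \<Rightarrow> (('h \<Rightarrow> 'h) \<Rightarrow> complex) \<Rightarrow> (('h \<Rightarrow> 'h) \<Rightarrow> complex) \<Rightarrow> real" where
  "state_metric X \<phi> \<psi> = enn2real (state_dist X \<phi> \<psi>)"

text \<open>The finiteness clause is needed since \<^const>\<open>enn2real\<close> maps \<open>\<infinity>\<close> to 0.\<close>

definition metrizes_weak_star :: "'h spectral_triple \<Rightarrow> bool" where
  "metrizes_weak_star X \<longleftrightarrow>
     (\<forall>\<phi>\<in>states X. \<forall>\<psi>\<in>states X. state_dist X \<phi> \<psi> < \<infinity>) \<and>
     Metric_space (states X) (state_metric X) \<and>
     Metric_space.mtopology (states X) (state_metric X) =
       weak_star_topology (hilb X) (opsys X)"


section \<open>Approximate order isomorphisms\<close>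

definition positive_unital ::
    "'h spectral_triple \<Rightarrow> 'k spectral_triple \<Rightarrow> (('h \<Rightarrow> 'h) \<Rightarrow> ('k \<Rightarrow> 'k)) \<Rightarrow> bool" where
  "positive_unital X Y F \<longleftrightarrow>
     F \<in> linear_maps (opsys_module (hilb X) (opsys X)) (opsys_module (hilb Y) (opsys Y)) \<and>
     (\<forall>T\<in>opsys X. positive_op (hilb X) T \<longrightarrow> positive_op (hilb Y) (F T)) \<and>
     F (identity_op (hilb X)) = identity_op (hilb Y)"

definition C1_contractive ::
    "'h spectral_triple \<Rightarrow> 'k spectral_triple \<Rightarrow> (('h \<Rightarrow> 'h) \<Rightarrow> ('k \<Rightarrow> 'k)) \<Rightarrow> bool" where
  "C1_contractive X Y F \<longleftrightarrow>
     (\<forall>T\<in>opsys X. opnorm (hilb Y) (F T) \<le> opnorm (hilb X) T) \<and>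
     F ` smooth X \<subseteq> smooth Y \<and>
     (\<forall>T\<in>smooth X. lip Y (F T) \<le> lip X T)"

definition approximate_order_isomorphism ::
    "(nat \<Rightarrow> 'k spectral_triple) \<Rightarrow> 'h spectral_triple \<Rightarrow>
     (nat \<Rightarrow> ('h \<Rightarrow> 'h) \<Rightarrow> ('k \<Rightarrow> 'k)) \<Rightarrow> (nat \<Rightarrow> ('k \<Rightarrow> 'k) \<Rightarrow> ('h \<Rightarrow> 'h)) \<Rightarrow> bool" where
  "approximate_order_isomorphism Y X R S \<longleftrightarrow>
     (\<forall>n. positive_unital X (Y n) (R n) \<and> positive_unital (Y n) X (S n)) \<and>
     (\<exists>\<gamma> \<gamma>' :: nat \<Rightarrow> real.
        (\<forall>n. 0 \<le> \<gamma> n \<and> 0 \<le> \<gamma>' n) \<and> \<gamma> \<longlonglongrightarrow> 0 \<and> \<gamma>' \<longlonglongrightarrow> 0 \<and>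
        (\<forall>n. \<forall>a\<in>smooth X. opdist (hilb X) (S n (R n a)) a \<le> ennreal (\<gamma> n) * lip X a) \<and>
        (\<forall>n. \<forall>h\<in>smooth (Y n).
           opdist (hilb (Y n)) (R n (S n h)) h \<le> ennreal (\<gamma>' n) * lip (Y n) h))"

definition C1_approximate_order_isomorphism ::
    "(nat \<Rightarrow> 'k spectral_triple) \<Rightarrow> 'h spectral_triple \<Rightarrow>
     (nat \<Rightarrow> ('h \<Rightarrow> 'h) \<Rightarrow> ('k \<Rightarrow> 'k)) \<Rightarrow> (nat \<Rightarrow> ('k \<Rightarrow> 'k) \<Rightarrow> ('h \<Rightarrow> 'h)) \<Rightarrow> bool" where
  "C1_approximate_order_isomorphism Y X R S \<longleftrightarrow>
     approximate_order_isomorphism Y X R S \<and>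
     (\<forall>n. C1_contractive X (Y n) (R n) \<and> C1_contractive (Y n) X (S n))"


section \<open>Gromov--Hausdorff distance\<close>

definition hausdorff_distance :: "('a \<Rightarrow> 'a \<Rightarrow> real) \<Rightarrow> 'a set \<Rightarrow> 'a set \<Rightarrow> ennreal" where
  "hausdorff_distance d A B =
     max (SUP a\<in>A. INF b\<in>B. ennreal (d a b)) (SUP b\<in>B. INF a\<in>A. ennreal (d a b))"

definition isometric_embedding ::
    "'a set \<Rightarrow> ('a \<Rightarrow> 'a \<Rightarrow> real) \<Rightarrow> 'c set \<Rightarrow> ('c \<Rightarrow> 'c \<Rightarrow> real) \<Rightarrow> ('a \<Rightarrow> 'c) \<Rightarrow> bool" where
  "isometric_embedding M d Z dZ f \<longleftrightarrow>
     f ` M \<subseteq> Z \<and> (\<forall>x\<in>M. \<forall>y\<in>M. dZ (f x) (f y) = d x y)"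

text \<open>
  The infimum of the Hausdorff distances over all isometric embeddings into a common metric space.
  Only the union of the two images matters, and it has no more points than the disjoint union of
  the two spaces, so it suffices that the common space ranges over subsets of the sum type.
\<close>

definition gromov_hausdorff_distance ::
    "'a set \<Rightarrow> ('a \<Rightarrow> 'a \<Rightarrow> real) \<Rightarrow> 'b set \<Rightarrow> ('b \<Rightarrow> 'b \<Rightarrow> real) \<Rightarrow> ennreal" where
  "gromov_hausdorff_distance M dM N dN =
     Inf {hausdorff_distance dZ (f ` M) (g ` N) | Z dZ f g.
         Metric_space (Z :: ('a + 'b) set) dZ \<and>
         isometric_embedding M dM Z dZ f \<and> isometric_embedding N dN Z dZ g}"

end

theory Submission
  imports Defs
begin

text \<open>
  Precomposition with \<open>R\<^sub>n\<close> and \<open>S\<^sub>n\<close> turns states of one operator system into states of the other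
  (\<open>pullback_state_in_states\<close>), and both pullbacks are nonexpansive for the state metrics: \<open>R\<^sub>n\<close> and
  \<open>S\<^sub>n\<close> send elements of Lipschitz seminorm at most 1 to such elements, so the supremum defining the
  distance of the pulled back states runs over fewer elements. The two pullbacks are nearly inverse
  to each other: a state \<open>\<phi>\<close> has norm 1, so
  \<open>\<bar>\<phi> (R\<^sub>n (S\<^sub>n h)) - \<phi> h\<bar> \<le> \<parallel>R\<^sub>n (S\<^sub>n h) - h\<parallel> \<le> \<gamma>'\<^sub>n\<close> whenever \<open>h\<close> has Lipschitz seminorm at most 1,
  which bounds the distance from \<open>\<phi>\<close> to its double pullback by \<open>\<gamma>'\<^sub>n\<close>; on the other side the bound
  is \<open>\<gamma>\<^sub>n\<close>.

  What remains is metric geometry (\<open>gromov_hausdorff_distance_le\<close>). If nonexpansive maps \<open>f\<close> from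
  \<open>M\<close> to \<open>N\<close> and \<open>g\<close> back are inverse to each other up to errors \<open>\<epsilon>\<close> and \<open>\<delta>\<close>, then \<open>f\<close> distorts
  distances by at most \<open>2 \<epsilon>\<close>, and one can glue \<open>M\<close> to \<open>N\<close> by placing each \<open>x\<close> at distance \<open>\<epsilon>\<close>
  from \<open>f x\<close>. In the glued space the two pieces have Hausdorff distance at most \<open>\<delta> + \<epsilon>\<close>.

  The one fact about operators behind this is that states are unital (\<open>state_identity\<close>). It is what
  makes the pullback of a state have norm exactly 1, and it rests on the adjoints in the operator
  system, since they supply enough positive elements.
\<close>

section \<open>Gluing metric spaces along an approximate isometry\<close>

text \<open>
  The distance between the pieces is the length of the shortest path through the segments of length
  \<open>\<epsilon>\<close> that join each \<open>x\<close> to \<open>f x\<close>. As \<open>f\<close> does not expand distances, leaving \<open>x\<close> at once along its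
  own segment is optimal, so no infimum over the crossing point is needed.
\<close>
fun glued_dist ::
    "('a \<Rightarrow> 'a \<Rightarrow> real) \<Rightarrow> ('b \<Rightarrow> 'b \<Rightarrow> real) \<Rightarrow> ('a \<Rightarrow> 'b) \<Rightarrow> real \<Rightarrow> 'a + 'b \<Rightarrow> 'a + 'b \<Rightarrow> real" where
  "glued_dist dM dN f \<epsilon> (Inl x) (Inl x') = dM x x'"
| "glued_dist dM dN f \<epsilon> (Inl x) (Inr y) = dN (f x) y + \<epsilon>"
| "glued_dist dM dN f \<epsilon> (Inr y) (Inl x) = dN (f x) y + \<epsilon>"
| "glued_dist dM dN f \<epsilon> (Inr y) (Inr y') = dN y y'"

text \<open>
  The two hypotheses on \<open>f\<close> serve the two triangles with two corners in \<open>M\<close>: nonexpansiveness when a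
  path moves within \<open>M\<close> before crossing, the distortion bound when it leaves \<open>M\<close> and returns, which
  costs two crossings and hence \<open>2 * \<epsilon>\<close>.
\<close>
lemma Metric_space_glued_dist:
  assumes M: "Metric_space M dM" and N: "Metric_space N dN" and f: "f \<in> M \<rightarrow> N" and "\<epsilon> > 0"
    and nonexpansive: "\<And>x x'. \<lbrakk>x \<in> M; x' \<in> M\<rbrakk> \<Longrightarrow> dN (f x) (f x') \<le> dM x x'"
    and distortion: "\<And>x x'. \<lbrakk>x \<in> M; x' \<in> M\<rbrakk> \<Longrightarrow> dM x x' \<le> dN (f x) (f x') + 2 * \<epsilon>"
  shows "Metric_space (M <+> N) (glued_dist dM dN f \<epsilon>)"
proof -
  interpret M: Metric_space M dM by fact
  interpret N: Metric_space N dN by fact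
  have pos: "0 < dN y y' + \<epsilon>" for y y'
    using N.nonneg[of y y'] \<open>\<epsilon> > 0\<close> by linarith
  have ne: "dN y y' + \<epsilon> \<noteq> 0" for y y'
    using pos[of y y'] by linarith
  show ?thesis
  proof
    show "0 \<le> glued_dist dM dN f \<epsilon> u v" for u v
      using \<open>\<epsilon> > 0\<close> by (cases u; cases v) auto
    show "glued_dist dM dN f \<epsilon> u v = glued_dist dM dN f \<epsilon> v u" for u v
      by (cases u; cases v) (auto simp: M.commute N.commute)
    show "glued_dist dM dN f \<epsilon> u v = 0 \<longleftrightarrow> u = v" if "u \<in> M <+> N" "v \<in> M <+> N" for u v
      using that ne by auto
    show "glued_dist dM dN f \<epsilon> u w \<le> glued_dist dM dN f \<epsilon> u v + glued_dist dM dN f \<epsilon> v w"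
      if uvw: "u \<in> M <+> N" "v \<in> M <+> N" "w \<in> M <+> N" for u v w
    proof -
      \<comment> \<open>Each name lists the pieces (left \<open>M\<close>, right \<open>N\<close>) that \<open>u\<close>, \<open>v\<close>, \<open>w\<close> lie in.\<close>
      have LLR: "dN (f x) y + \<epsilon> \<le> dM x x' + (dN (f x') y + \<epsilon>)"
        if "x \<in> M" "x' \<in> M" "y \<in> N" for x x' y
        using that f nonexpansive[of x x'] N.triangle[of "f x" "f x'" y] by force
      have LRL: "dM x x' \<le> dN (f x) y + \<epsilon> + (dN (f x') y + \<epsilon>)"
        if "x \<in> M" "x' \<in> M" "y \<in> N" for x x' y
        using that f distortion[of x x'] N.triangle[of "f x" y "f x'"] N.commute[of y "f x'"]
        by force
      have LRR: "dN (f x) y + \<epsilon> \<le> dN (f x) y' + \<epsilon> + dN y' y"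
        if "x \<in> M" "y \<in> N" "y' \<in> N" for x y y'
        using that f N.triangle[of "f x" y' y] by force
      have RLR: "dN y y' \<le> dN (f x) y + \<epsilon> + (dN (f x) y' + \<epsilon>)"
        if "x \<in> M" "y \<in> N" "y' \<in> N" for x y y'
        using that f \<open>\<epsilon> > 0\<close> N.triangle[of y "f x" y'] N.commute[of y "f x"] by force
      have RLL: "dN (f x) y + \<epsilon> \<le> dN (f x') y + \<epsilon> + dM x' x"
        if "x \<in> M" "x' \<in> M" "y \<in> N" for x x' y
        using LLR[OF that] M.commute[of x x'] by linarith
      have RRL: "dN (f x) y + \<epsilon> \<le> dN y y' + (dN (f x) y' + \<epsilon>)"
        if "x \<in> M" "y \<in> N" "y' \<in> N" for x y y'
        using LRR[OF that] N.commute[of y y'] by linarith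
      show ?thesis
        using uvw by (elim PlusE; hypsubst; unfold glued_dist.simps;
          intro M.triangle N.triangle LLR LRL LRR RLL RLR RRL)
    qed
  qed
qed

text \<open>
  The map \<open>g\<close> recovers the distances that \<open>f\<close> may have shrunk: up to \<open>\<epsilon>\<close> at each end, \<open>x\<close> and \<open>x'\<close>
  are the images under \<open>g\<close> of \<open>f x\<close> and \<open>f x'\<close>. Hence gluing along \<open>f\<close> with gap \<open>\<epsilon>\<close> works. Every
  \<open>x\<close> is within \<open>\<epsilon>\<close> of \<open>f x\<close>, and every \<open>y\<close> is within \<open>\<delta> + \<epsilon>\<close> of \<open>g y\<close>.
\<close>
lemma gromov_hausdorff_distance_le:
  fixes M :: "'a set" and N :: "'b set"
  assumes M: "Metric_space M dM" and N: "Metric_space N dN"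
    and f: "f \<in> M \<rightarrow> N" and g: "g \<in> N \<rightarrow> M"
    and f_nonexpansive: "\<And>x x'. \<lbrakk>x \<in> M; x' \<in> M\<rbrakk> \<Longrightarrow> dN (f x) (f x') \<le> dM x x'"
    and g_nonexpansive: "\<And>y y'. \<lbrakk>y \<in> N; y' \<in> N\<rbrakk> \<Longrightarrow> dM (g y) (g y') \<le> dN y y'"
    and gf: "\<And>x. x \<in> M \<Longrightarrow> dM (g (f x)) x \<le> \<epsilon>"
    and fg: "\<And>y. y \<in> N \<Longrightarrow> dN (f (g y)) y \<le> \<delta>"
    and "\<epsilon> > 0" "\<delta> \<ge> 0"
  shows "gromov_hausdorff_distance M dM N dN \<le> ennreal (\<delta> + \<epsilon>)"
proof -
  interpret M: Metric_space M dM by fact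
  interpret N: Metric_space N dN by fact
  let ?d = "glued_dist dM dN f \<epsilon>"
  have "dM x x' \<le> dN (f x) (f x') + 2 * \<epsilon>" if "x \<in> M" "x' \<in> M" for x x'
  proof -
    have "f x \<in> N" "f x' \<in> N" "g (f x) \<in> M" "g (f x') \<in> M"
      using that f g by auto
    then show ?thesis
      using M.triangle[of x "g (f x)" x'] M.triangle[of "g (f x)" "g (f x')" x']
        g_nonexpansive[of "f x" "f x'"] gf[of x] gf[of x'] M.commute[of x "g (f x)"] that
      by linarith
  qed
  then have "Metric_space (M <+> N) ?d"
    using Metric_space_glued_dist[OF M N f \<open>\<epsilon> > 0\<close> f_nonexpansive] by blast
  moreover have "isometric_embedding M dM (M <+> N) ?d Inl"
    and "isometric_embedding N dN (M <+> N) ?d Inr"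
    by (auto simp: isometric_embedding_def)
  ultimately have "gromov_hausdorff_distance M dM N dN \<le> hausdorff_distance ?d (Inl ` M) (Inr ` N)"
    unfolding gromov_hausdorff_distance_def by (intro Inf_lower) blast
  also have "\<dots> \<le> ennreal (\<delta> + \<epsilon>)"
  proof -
    have "(INF v\<in>Inr ` N. ennreal (?d (Inl x) v)) \<le> ennreal (\<delta> + \<epsilon>)" if "x \<in> M" for x
      using that f \<open>\<delta> \<ge> 0\<close> by (intro INF_lower2[of "Inr (f x)"]) (auto intro!: ennreal_leI simp: Pi_iff)
    moreover have "(INF u\<in>Inl ` M. ennreal (?d u (Inr y))) \<le> ennreal (\<delta> + \<epsilon>)" if "y \<in> N" for y
      using that g fg[of y] by (intro INF_lower2[of "Inl (g y)"]) (auto intro!: ennreal_leI)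
    ultimately show ?thesis
      unfolding hausdorff_distance_def by (auto intro!: SUP_least)
  qed
  finally show ?thesis .
qed


section \<open>Contractions on a Hilbert space\<close>

lemma complex_module_simps [simp]:
  "carrier complex_module = UNIV" "monoid.mult complex_module = (*)" "one complex_module = 1"
  "zero complex_module = 0" "add complex_module = (+)" "smult complex_module = (*)"
  by (simp_all add: complex_module_def)

lemma bounded_operators_simps [simp]:
  "carrier (bounded_operators H) = {T \<in> linear_maps H H. opnorm H T < \<infinity>}"
  "add (bounded_operators H) = (\<lambda>S T. \<lambda>x\<in>carrier H. S x \<oplus>\<^bsub>H\<^esub> T x)"
  "smult (bounded_operators H) = (\<lambda>c T. \<lambda>x\<in>carrier H. c \<odot>\<^bsub>H\<^esub> T x)"
  by (simp_all add: bounded_operators_def)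

context hilbert_space
begin

lemma smult_in_carrier [simp]: "x \<in> carrier H \<Longrightarrow> c \<odot> x \<in> carrier H"
  using smult_closed[of c x] by simp

lemma uminus_eq_smult: "x \<in> carrier H \<Longrightarrow> \<ominus> x = (-1) \<odot> x"
proof -
  assume x: "x \<in> carrier H"
  have "(-1) \<odot> x \<oplus> x = ((-1) + 1) \<odot> x"
    using smult_l_distr[of "-1" 1 x] smult_one[OF x] x by simp
  also have "\<dots> = \<zero>"
    using smult_l_null[OF x] by simp
  finally show ?thesis
    using x by (intro M.minus_equality) simp_all
qed

lemma minus_eq_smult: "\<lbrakk>x \<in> carrier H; y \<in> carrier H\<rbrakk> \<Longrightarrow> x \<ominus> y = x \<oplus> (-1) \<odot> y"
  by (simp add: M.minus_eq uminus_eq_smult)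

lemma cinner_add_left:
  "\<lbrakk>x \<in> carrier H; y \<in> carrier H; z \<in> carrier H\<rbrakk>
    \<Longrightarrow> cinner H (x \<oplus> y) z = cinner H x z + cinner H y z"
  using cinner_add[of z x y] cinner_commute[of z x] cinner_commute[of z y] cinner_commute[of z "x \<oplus> y"]
  by simp

lemma cinner_smult_left:
  "\<lbrakk>x \<in> carrier H; y \<in> carrier H\<rbrakk> \<Longrightarrow> cinner H (c \<odot> x) y = cnj c * cinner H x y"
  using cinner_smult[of y x c] cinner_commute[of y x] cinner_commute[of y "c \<odot> x"] by simp

lemma cinner_self_real: "x \<in> carrier H \<Longrightarrow> cinner H x x \<in> \<real>"
  using cinner_commute[of x x] by (simp add: Reals_cnj_iff)

lemma cinner_self_nonneg: "x \<in> carrier H \<Longrightarrow> 0 \<le> Re (cinner H x x)"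
proof (cases "x = \<zero>")
  case True
  then have "cinner H x x = 0"
    using cinner_smult[of x x 0] smult_l_null[of x] by simp
  then show ?thesis by simp
qed (use cinner_pos in fastforce)

lemma hnorm_smult: "x \<in> carrier H \<Longrightarrow> hnorm H (c \<odot> x) = cmod c * hnorm H x"
proof -
  assume x: "x \<in> carrier H"
  have "cinner H (c \<odot> x) (c \<odot> x) = of_real ((cmod c)\<^sup>2) * cinner H x x"
    using x by (simp add: cinner_smult cinner_smult_left complex_norm_square mult_ac
      flip: of_real_power)
  then show ?thesis
    by (simp add: hnorm_def real_sqrt_mult)
qed

text \<open>
  Expanding \<open>x \<ominus> y\<close> against itself gives this substitute for Cauchy--Schwarz, which is all that the
  positivity argument for contractions needs.
\<close>
lemma two_Re_cinner_le:
  assumes x: "x \<in> carrier H" and y: "y \<in> carrier H"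
  shows "2 * Re (cinner H x y) \<le> Re (cinner H x x) + Re (cinner H y y)"
proof -
  have "cinner H (x \<ominus> y) (x \<ominus> y) = cinner H x x - cinner H x y - cinner H y x + cinner H y y"
    using x y
    by (simp add: minus_eq_smult cinner_add cinner_add_left cinner_smult cinner_smult_left)
  moreover have "Re (cinner H y x) = Re (cinner H x y)"
    using cinner_commute[OF x y] by simp
  ultimately show ?thesis
    using cinner_self_nonneg[of "x \<ominus> y"] x y by simp
qed

lemma linear_map_closed: "\<lbrakk>T \<in> linear_maps H H; x \<in> carrier H\<rbrakk> \<Longrightarrow> T x \<in> carrier H"
  by (auto simp: linear_maps_def)

lemma contraction_cinner_le:
  assumes T: "T \<in> linear_maps H H" and norm: "opnorm H T \<le> 1" and x: "x \<in> carrier H"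
  shows "Re (cinner H (T x) (T x)) \<le> Re (cinner H x x)"
proof (cases "x = \<zero>")
  case True
  have "T (0 \<odot> x) = 0 \<odot> T x"
    using T x by (simp add: linear_maps_def)
  then have "T x = 0 \<odot> T x"
    using smult_l_null[OF x] True by simp
  also have "\<dots> = x"
    using smult_l_null[OF linear_map_closed[OF T x]] True by simp
  finally show ?thesis by simp
next
  case False
  let ?r = "hnorm H x"
  have r: "?r > 0"
    using cinner_pos[OF x False] by (simp add: hnorm_def)
  let ?u = "of_real (inverse ?r) \<odot> x"
  have u: "?u \<in> carrier H" "hnorm H ?u \<le> 1"
    using x r by (simp_all add: hnorm_smult norm_inverse)
  have "ennreal (hnorm H (T ?u)) \<le> opnorm H T"
    unfolding opnorm_on_def by (intro SUP_upper) (use u in simp)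
  then have "hnorm H (T ?u) \<le> 1"
    using norm by (intro order_trans[THEN ennreal_le_1[THEN iffD1]])
  moreover have "T ?u = of_real (inverse ?r) \<odot> T x"
    using T x by (simp add: linear_maps_def)
  ultimately have "inverse ?r * hnorm H (T x) \<le> 1"
    using r linear_map_closed[OF T x] by (simp add: hnorm_smult norm_inverse)
  then have "hnorm H (T x) \<le> ?r"
    using r by (simp add: field_simps)
  then show ?thesis
    by (simp add: hnorm_def)
qed

lemma opnorm_smult:
  assumes "T \<in> linear_maps H H"
  shows "opnorm H (\<lambda>x\<in>carrier H. c \<odot> T x) = ennreal (cmod c) * opnorm H T"
  unfolding opnorm_on_def SUP_mult_left_ennreal
  using linear_map_closed[OF assms]
  by (intro SUP_cong) (simp_all add: hnorm_smult ennreal_mult')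

end


section \<open>States are unital\<close>

locale hilbert_operator_system = hilbert_space +
  fixes E :: "('a \<Rightarrow> 'a) set"
  assumes operator_system: "operator_system H E"
begin

lemma opsys_submodule: "submodule E complex_module (bounded_operators H)"
  and identity_in_opsys: "identity_op H \<in> E"
  using operator_system by (simp_all add: operator_system_def)

lemma opsys_linear: "T \<in> E \<Longrightarrow> T \<in> linear_maps H H"
  using subgroup.subset[OF submodule.axioms(1)[OF opsys_submodule]] by auto

lemma opsys_apply_closed [simp]: "\<lbrakk>T \<in> E; x \<in> carrier H\<rbrakk> \<Longrightarrow> T x \<in> carrier H"
  using opsys_linear linear_map_closed by blast

lemma opsys_add_closed: "\<lbrakk>S \<in> E; T \<in> E\<rbrakk> \<Longrightarrow> S \<oplus>\<^bsub>bounded_operators H\<^esub> T \<in> E"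
  using subgroup.m_closed[OF submodule.axioms(1)[OF opsys_submodule], of S T] by simp

lemma opsys_smult_closed: "T \<in> E \<Longrightarrow> c \<odot>\<^bsub>bounded_operators H\<^esub> T \<in> E"
  using submodule.smult_closed[OF opsys_submodule, of c T] by simp

lemma opsys_adjointE:
  assumes "T \<in> E"
  obtains T' where "T' \<in> E"
    and "\<And>x y. \<lbrakk>x \<in> carrier H; y \<in> carrier H\<rbrakk> \<Longrightarrow> cinner H y (T x) = cinner H (T' y) x"
proof -
  obtain T' where T': "T' \<in> E" "adjoint_graph H (carrier H) T = {(y, T' y) | y. y \<in> carrier H}"
    using operator_system assms unfolding operator_system_def by blast
  then have "(y, T' y) \<in> adjoint_graph H (carrier H) T" if "y \<in> carrier H" for y
    using that by blast
  then show thesis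
    using that T' by (auto simp: adjoint_graph_def)
qed

lemma positive_identity_op: "positive_op H (identity_op H)"
  by (auto simp: positive_op_def identity_op_def complex_nonneg_Reals_iff cinner_self_nonneg
      cinner_self_real complex_is_Real_iff[symmetric])

lemma opnorm_identity_op: "opnorm H (identity_op H) \<le> 1"
  by (auto simp: opnorm_on_def identity_op_def intro!: SUP_least)

text \<open>
  With \<open>A'\<close> the adjoint of a contraction \<open>A\<close>, the operator \<open>2 - (A + A')\<close> has the quadratic form
  \<open>2 \<langle>x, x\<rangle> - 2 Re \<langle>x, A x\<rangle>\<close>, and \<open>Re \<langle>x, A x\<rangle> \<le> \<langle>x, x\<rangle>\<close>. These are the positive elements on which
  states are tested below.
\<close>
lemma positive_op_two_minus_twice_real_part:
  assumes A: "A \<in> E" "opnorm H A \<le> 1" and A': "A' \<in> E"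
    and adjoint: "\<And>x y. \<lbrakk>x \<in> carrier H; y \<in> carrier H\<rbrakk> \<Longrightarrow> cinner H y (A x) = cinner H (A' y) x"
  shows "positive_op H (2 \<odot>\<^bsub>bounded_operators H\<^esub> identity_op H
    \<oplus>\<^bsub>bounded_operators H\<^esub> (-1) \<odot>\<^bsub>bounded_operators H\<^esub> (A \<oplus>\<^bsub>bounded_operators H\<^esub> A'))"
    (is "positive_op H ?P")
  unfolding positive_op_def
proof
  fix x assume x: "x \<in> carrier H"
  have "?P x = 2 \<odot> x \<oplus> (-1) \<odot> (A x \<oplus> A' x)"
    using x by (simp add: identity_op_def)
  moreover have "cinner H x (A' x) = cnj (cinner H x (A x))"
    using cinner_commute[of "A' x" x] adjoint[OF x x] x A' by simp
  ultimately have *: "cinner H x (?P x) = 2 * cinner H x x - (cinner H x (A x) + cnj (cinner H x (A x)))"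
    using x A A' by (simp add: cinner_add cinner_smult)
  have "2 * Re (cinner H x (A x)) \<le> Re (cinner H x x) + Re (cinner H (A x) (A x))"
    using two_Re_cinner_le[of x "A x"] x A by simp
  also have "\<dots> \<le> 2 * Re (cinner H x x)"
    using contraction_cinner_le[OF opsys_linear A(2) x] A(1) by simp
  finally show "cinner H x (?P x) \<in> \<real>\<^sub>\<ge>\<^sub>0"
    using cinner_self_real[OF x] unfolding * by (simp add: complex_nonneg_Reals_iff complex_is_Real_iff)
qed

context
  fixes \<phi>
  assumes state: "\<phi> \<in> state_space H E"
begin

lemma state_add:
  "\<lbrakk>S \<in> E; T \<in> E\<rbrakk> \<Longrightarrow> \<phi> (S \<oplus>\<^bsub>bounded_operators H\<^esub> T) = \<phi> S + \<phi> T"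
  using state by (simp add: state_space_def linear_maps_def)

lemma state_smult: "T \<in> E \<Longrightarrow> \<phi> (c \<odot>\<^bsub>bounded_operators H\<^esub> T) = c * \<phi> T"
  using state by (simp add: state_space_def linear_maps_def)

lemma state_nonneg: "\<lbrakk>T \<in> E; positive_op H T\<rbrakk> \<Longrightarrow> \<phi> T \<in> \<real>\<^sub>\<ge>\<^sub>0"
  using state by (simp add: state_space_def)

lemma functional_norm_state: "functional_norm H E \<phi> = 1"
  using state by (simp add: state_space_def)

lemma cmod_state_le_1:
  assumes "T \<in> E" "opnorm H T \<le> 1"
  shows "cmod (\<phi> T) \<le> 1"
proof -
  have "ennreal (cmod (\<phi> T)) \<le> functional_norm H E \<phi>"
    unfolding functional_norm_def by (intro SUP_upper) (use assms in simp)
  then show ?thesis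
    by (simp add: functional_norm_state)
qed

text \<open>
  The strictly positive bound \<open>r\<close> makes it possible to rescale \<open>T\<close> into the unit ball even if the
  norm of \<open>T\<close> vanishes.
\<close>
lemma cmod_state_le:
  assumes T: "T \<in> E" "opnorm H T \<le> ennreal r" and r: "r > 0"
  shows "cmod (\<phi> T) \<le> r"
proof -
  let ?S = "of_real (inverse r) \<odot>\<^bsub>bounded_operators H\<^esub> T"
  have "opnorm H ?S = ennreal (inverse r) * opnorm H T"
    using opnorm_smult[OF opsys_linear, of T "of_real (inverse r)"] T r by (simp add: norm_inverse)
  also have "\<dots> \<le> ennreal (inverse r) * ennreal r"
    using T by (intro mult_left_mono) auto
  also have "\<dots> = 1"
    using r by (simp flip: ennreal_mult)
  finally have "cmod (\<phi> ?S) \<le> 1"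
    using cmod_state_le_1 opsys_smult_closed T by blast
  then have "inverse r * cmod (\<phi> T) \<le> 1"
    using state_smult[OF T(1), of "of_real (inverse r)"] r
    by (simp add: norm_mult norm_inverse del: bounded_operators_simps)
  then show ?thesis
    using r by (simp add: field_simps)
qed

text \<open>
  A positive functional attains its norm at the identity. For \<open>\<bar>c\<bar> = 1\<close> the operator \<open>c A\<close> is again a
  contraction, with adjoint \<open>cnj c A'\<close>, so positivity of \<open>2 - (c A + cnj c A')\<close> yields an inequality
  for each such \<open>c\<close>. That the values are real for \<open>c = 1\<close> and \<open>c = \<i>\<close> forces \<open>\<phi> A' = cnj (\<phi> A)\<close>;
  the inequality for the \<open>c\<close> with \<open>c \<phi> A = \<bar>\<phi> A\<bar>\<close> is then the claim.
\<close>
lemma cmod_state_le_state_identity: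
  assumes A: "A \<in> E" "opnorm H A \<le> 1"
  shows "cmod (\<phi> A) \<le> Re (\<phi> (identity_op H))"
proof -
  let ?B = "bounded_operators H"
  let ?one = "\<phi> (identity_op H)"
  obtain A' where A': "A' \<in> E"
    and adjoint: "\<And>x y. \<lbrakk>x \<in> carrier H; y \<in> carrier H\<rbrakk> \<Longrightarrow> cinner H y (A x) = cinner H (A' y) x"
    using opsys_adjointE A by blast
  have rotated: "2 * ?one - (c * \<phi> A + cnj c * \<phi> A') \<in> \<real>\<^sub>\<ge>\<^sub>0" if c: "cmod c = 1" for c
  proof -
    let ?C = "c \<odot>\<^bsub>?B\<^esub> A" and ?C' = "cnj c \<odot>\<^bsub>?B\<^esub> A'"
    let ?P = "2 \<odot>\<^bsub>?B\<^esub> identity_op H \<oplus>\<^bsub>?B\<^esub> (-1) \<odot>\<^bsub>?B\<^esub> (?C \<oplus>\<^bsub>?B\<^esub> ?C')"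
    have C: "?C \<in> E" "?C' \<in> E"
      using A A' opsys_smult_closed by blast+
    have "opnorm H ?C \<le> 1"
      using opnorm_smult[OF opsys_linear, of A c] A c by simp
    moreover have "cinner H y (?C x) = cinner H (?C' y) x" if "x \<in> carrier H" "y \<in> carrier H" for x y
      using that A A' by (simp add: cinner_smult cinner_smult_left adjoint)
    ultimately have "positive_op H ?P"
      using positive_op_two_minus_twice_real_part C by blast
    moreover have "?P \<in> E"
      using C identity_in_opsys opsys_add_closed opsys_smult_closed by blast
    ultimately have "\<phi> ?P \<in> \<real>\<^sub>\<ge>\<^sub>0"
      by (rule state_nonneg[rotated])
    moreover have "\<phi> ?P = 2 * ?one + (-1) * (c * \<phi> A + cnj c * \<phi> A')"
      using A A' C identity_in_opsys
      by (simp only: state_add state_smult opsys_add_closed opsys_smult_closed)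
    ultimately have "2 * ?one + (-1) * (c * \<phi> A + cnj c * \<phi> A') \<in> \<real>\<^sub>\<ge>\<^sub>0"
      by (simp only:)
    then show ?thesis
      by (simp add: algebra_simps)
  qed
  have one: "?one \<in> \<real>\<^sub>\<ge>\<^sub>0"
    using state_nonneg identity_in_opsys positive_identity_op by blast
  have "\<phi> A' = cnj (\<phi> A)"
    using rotated[of 1] rotated[of \<i>] one
    by (simp add: complex_nonneg_Reals_iff complex_eq_iff)
  then have *: "2 * Re (c * \<phi> A) \<le> 2 * Re ?one" if "cmod c = 1" for c
    using rotated[OF that] by (simp add: complex_nonneg_Reals_iff)
  show ?thesis
  proof (cases "\<phi> A = 0")
    case True
    then show ?thesis
      using one by (simp add: complex_nonneg_Reals_iff)
  next
    case False
    let ?c = "cnj (\<phi> A) / cmod (\<phi> A)"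
    have "?c * \<phi> A = cmod (\<phi> A)"
      using False complex_norm_square[of "\<phi> A"] by (simp add: field_simps power2_eq_square)
    moreover have "cmod ?c = 1"
      using False by (simp add: norm_divide)
    ultimately show ?thesis
      using *[of ?c] by simp
  qed
qed

lemma state_identity: "\<phi> (identity_op H) = 1"
proof -
  have one: "\<phi> (identity_op H) \<in> \<real>\<^sub>\<ge>\<^sub>0"
    using state_nonneg identity_in_opsys positive_identity_op by blast
  have "functional_norm H E \<phi> \<le> ennreal (Re (\<phi> (identity_op H)))"
    unfolding functional_norm_def
    by (auto intro!: SUP_least ennreal_leI cmod_state_le_state_identity)
  then have "1 \<le> Re (\<phi> (identity_op H))"
    unfolding functional_norm_state by simp
  moreover have "Re (\<phi> (identity_op H)) \<le> 1"
    using cmod_state_le_1[OF identity_in_opsys opnorm_identity_op]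
      complex_Re_le_cmod[of "\<phi> (identity_op H)"] by linarith
  ultimately show ?thesis
    using one by (simp add: complex_nonneg_Reals_iff complex_eq_iff)
qed

end

end


section \<open>Pulling back states\<close>

lemma spectral_triple_opsys:
  assumes "operator_system_spectral_triple X"
  shows "hilbert_operator_system (hilb X) (opsys X)"
  using assms
  by (simp add: operator_system_spectral_triple_def hilbert_operator_system_def
      hilbert_operator_system_axioms_def)

lemma smooth_in_opsys:
  assumes "operator_system_spectral_triple X" "T \<in> smooth X"
  shows "T \<in> opsys X"
proof -
  have "submodule (smooth X) complex_module (opsys_module (hilb X) (opsys X))"
    using assms by (simp add: operator_system_spectral_triple_def)
  from subgroup.subset[OF submodule.axioms(1)[OF this]] show ?thesis
    using assms by auto
qed

abbreviation pullback_state ::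
    "'h spectral_triple \<Rightarrow> (('h \<Rightarrow> 'h) \<Rightarrow> ('k \<Rightarrow> 'k)) \<Rightarrow> (('k \<Rightarrow> 'k) \<Rightarrow> complex) \<Rightarrow>
      ('h \<Rightarrow> 'h) \<Rightarrow> complex" where
  "pullback_state X F \<phi> \<equiv> compose (opsys X) \<phi> F"

text \<open>
  Contractivity of \<open>F\<close> gives norm at most 1. The value 1 is attained at the identity, because \<open>F\<close> and
  the state \<open>\<phi>\<close> are both unital.
\<close>
lemma pullback_state_in_states:
  assumes X: "operator_system_spectral_triple X" and Y: "operator_system_spectral_triple Y"
    and F: "positive_unital X Y F" "C1_contractive X Y F" and \<phi>: "\<phi> \<in> states Y"
  shows "pullback_state X F \<phi> \<in> states X"
proof -
  interpret X: hilbert_operator_system "hilb X" "opsys X"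
    by (rule spectral_triple_opsys[OF X])
  interpret Y: hilbert_operator_system "hilb Y" "opsys Y"
    by (rule spectral_triple_opsys[OF Y])
  have F_closed: "F T \<in> opsys Y" if "T \<in> opsys X" for T
    using F that by (auto simp: positive_unital_def linear_maps_def)
  have F_norm: "opnorm (hilb Y) (F T) \<le> opnorm (hilb X) T" if "T \<in> opsys X" for T
    using F that by (simp add: C1_contractive_def)
  have add: "F (S \<oplus>\<^bsub>bounded_operators (hilb X)\<^esub> T) = F S \<oplus>\<^bsub>bounded_operators (hilb Y)\<^esub> F T"
    if "S \<in> opsys X" "T \<in> opsys X" for S T
    using F that by (simp add: positive_unital_def linear_maps_def)
  have smult: "F (c \<odot>\<^bsub>bounded_operators (hilb X)\<^esub> T) = c \<odot>\<^bsub>bounded_operators (hilb Y)\<^esub> F T"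
    if "T \<in> opsys X" for c T
    using F that by (simp add: positive_unital_def linear_maps_def)
  have "pullback_state X F \<phi> \<in> linear_maps (opsys_module (hilb X) (opsys X)) complex_module"
    using X.opsys_add_closed X.opsys_smult_closed add smult F_closed
      Y.state_add[OF \<phi>] Y.state_smult[OF \<phi>]
    by (simp add: linear_maps_def compose_def del: bounded_operators_simps)
  moreover have "pullback_state X F \<phi> T \<in> \<real>\<^sub>\<ge>\<^sub>0"
    if "T \<in> opsys X" "positive_op (hilb X) T" for T
    using that F Y.state_nonneg[OF \<phi>, of "F T"] F_closed[of T]
    by (simp add: positive_unital_def compose_def)
  moreover have "functional_norm (hilb X) (opsys X) (pullback_state X F \<phi>) = 1"
  proof (rule antisym)
    show "functional_norm (hilb X) (opsys X) (pullback_state X F \<phi>) \<le> 1"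
      unfolding functional_norm_def
    proof (rule SUP_least)
      fix T assume T: "T \<in> {T \<in> opsys X. opnorm (hilb X) T \<le> 1}"
      then have "cmod (\<phi> (F T)) \<le> 1"
        using F_closed F_norm[of T] by (intro Y.cmod_state_le_1[OF \<phi>]) auto
      with T show "ennreal (cmod (pullback_state X F \<phi> T)) \<le> 1"
        by (simp add: compose_def)
    qed
    have "pullback_state X F \<phi> (identity_op (hilb X)) = 1"
      using F Y.state_identity[OF \<phi>] X.identity_in_opsys
      by (simp add: positive_unital_def compose_def)
    then have "1 = ennreal (cmod (pullback_state X F \<phi> (identity_op (hilb X))))"
      by simp
    also have "\<dots> \<le> functional_norm (hilb X) (opsys X) (pullback_state X F \<phi>)"
      unfolding functional_norm_def
      by (intro SUP_upper) (simp add: X.identity_in_opsys X.opnorm_identity_op)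
    finally show "1 \<le> functional_norm (hilb X) (opsys X) (pullback_state X F \<phi>)" .
  qed
  ultimately show ?thesis
    by (simp add: state_space_def)
qed

lemma state_dist_pullback_state_le:
  assumes X: "operator_system_spectral_triple X" and F: "C1_contractive X Y F"
  shows "state_dist X (pullback_state X F \<phi>) (pullback_state X F \<psi>) \<le> state_dist Y \<phi> \<psi>"
  unfolding state_dist_def
proof (rule SUP_least)
  fix T assume T: "T \<in> {T \<in> smooth X. lip X T \<le> 1}"
  then have "F T \<in> {T \<in> smooth Y. lip Y T \<le> 1}"
    using F by (auto simp: C1_contractive_def intro: order_trans)
  moreover have "pullback_state X F \<phi> T - pullback_state X F \<psi> T = \<phi> (F T) - \<psi> (F T)"
    using smooth_in_opsys[OF X] T by (simp add: compose_def)
  ultimately show "ennreal (cmod (pullback_state X F \<phi> T - pullback_state X F \<psi> T))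
      \<le> (SUP T\<in>{T \<in> smooth Y. lip Y T \<le> 1}. ennreal (cmod (\<phi> T - \<psi> T)))"
    by (simp add: SUP_upper2)
qed

text \<open>
  The double pullback of \<open>\<phi>\<close> evaluates \<open>\<phi>\<close> at \<open>F (G h)\<close>, so its distance to \<open>\<phi>\<close> is governed by the
  norm of \<open>F (G h) - h\<close>, as states are bounded by the operator norm.
\<close>
lemma state_dist_pullback_pullback_le:
  assumes X: "operator_system_spectral_triple X" and Y: "operator_system_spectral_triple Y"
    and F: "positive_unital X Y F" and G: "positive_unital Y X G"
    and approx: "\<And>h. h \<in> smooth Y \<Longrightarrow> opdist (hilb Y) (F (G h)) h \<le> ennreal \<epsilon> * lip Y h"
    and "\<epsilon> > 0" and \<phi>: "\<phi> \<in> states Y"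
  shows "state_dist Y (pullback_state Y G (pullback_state X F \<phi>)) \<phi> \<le> ennreal \<epsilon>"
  unfolding state_dist_def
proof (rule SUP_least)
  interpret Y: hilbert_operator_system "hilb Y" "opsys Y"
    by (rule spectral_triple_opsys[OF Y])
  let ?B = "bounded_operators (hilb Y)"
  fix h assume h: "h \<in> {T \<in> smooth Y. lip Y T \<le> 1}"
  have hY: "h \<in> opsys Y"
    using smooth_in_opsys[OF Y] h by blast
  have GX: "G h \<in> opsys X"
    using G hY by (auto simp: positive_unital_def linear_maps_def)
  have FGY: "F (G h) \<in> opsys Y"
    using F GX by (auto simp: positive_unital_def linear_maps_def)
  let ?T = "F (G h) \<oplus>\<^bsub>?B\<^esub> (-1) \<odot>\<^bsub>?B\<^esub> h"
  have T: "?T \<in> opsys Y"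
    using hY FGY Y.opsys_add_closed Y.opsys_smult_closed by blast
  have "opnorm (hilb Y) ?T = opdist (hilb Y) (F (G h)) h"
    unfolding opdist_def opnorm_on_def
    using hY FGY by (intro SUP_cong) (simp_all add: Y.minus_eq_smult)
  also have "\<dots> \<le> ennreal \<epsilon> * lip Y h"
    using approx h by blast
  also have "\<dots> \<le> ennreal \<epsilon>"
    using h mult_left_mono[of "lip Y h" 1 "ennreal \<epsilon>"] by simp
  finally have "cmod (\<phi> ?T) \<le> \<epsilon>"
    using Y.cmod_state_le[OF \<phi> T] \<open>\<epsilon> > 0\<close> by blast
  moreover have "\<phi> ?T = \<phi> (F (G h)) + (-1) * \<phi> h"
    using hY FGY
    by (simp only: Y.state_add[OF \<phi>] Y.state_smult[OF \<phi>] Y.opsys_smult_closed)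
  moreover have "pullback_state Y G (pullback_state X F \<phi>) h = \<phi> (F (G h))"
    using hY GX by (simp add: compose_def)
  ultimately show "ennreal (cmod (pullback_state Y G (pullback_state X F \<phi>) h - \<phi> h)) \<le> ennreal \<epsilon>"
    by (simp add: ennreal_leI)
qed


section \<open>Convergence of state spaces\<close>

text \<open>
  That the distances are metrics, and finite, is what allows the bounds on the extended distances to
  be read as bounds in the real-valued metric spaces.
\<close>
lemma gromov_hausdorff_state_spaces_le:
  assumes X: "operator_system_spectral_triple X" and Y: "operator_system_spectral_triple Y"
    and mX: "metrizes_weak_star X" and mY: "metrizes_weak_star Y"
    and F: "positive_unital X Y F" "C1_contractive X Y F"
    and G: "positive_unital Y X G" "C1_contractive Y X G"
    and GF: "\<And>a. a \<in> smooth X \<Longrightarrow> opdist (hilb X) (G (F a)) a \<le> ennreal \<delta> * lip X a"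
    and FG: "\<And>h. h \<in> smooth Y \<Longrightarrow> opdist (hilb Y) (F (G h)) h \<le> ennreal \<epsilon> * lip Y h"
    and "\<delta> > 0" "\<epsilon> > 0"
  shows "gromov_hausdorff_distance (states Y) (state_metric Y) (states X) (state_metric X)
    \<le> ennreal (\<delta> + \<epsilon>)"
proof (rule gromov_hausdorff_distance_le)
  show "Metric_space (states Y) (state_metric Y)" "Metric_space (states X) (state_metric X)"
    using mX mY by (auto simp: metrizes_weak_star_def)
  have finX: "state_dist X \<phi> \<psi> < \<infinity>" if "\<phi> \<in> states X" "\<psi> \<in> states X" for \<phi> \<psi>
    using mX that by (simp add: metrizes_weak_star_def)
  have finY: "state_dist Y \<phi> \<psi> < \<infinity>" if "\<phi> \<in> states Y" "\<psi> \<in> states Y" for \<phi> \<psi>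
    using mY that by (simp add: metrizes_weak_star_def)
  show "pullback_state X F \<in> states Y \<rightarrow> states X"
    using pullback_state_in_states[OF X Y F] by blast
  show "pullback_state Y G \<in> states X \<rightarrow> states Y"
    using pullback_state_in_states[OF Y X G] by blast
  show "state_metric X (pullback_state X F \<phi>) (pullback_state X F \<psi>) \<le> state_metric Y \<phi> \<psi>"
    if "\<phi> \<in> states Y" "\<psi> \<in> states Y" for \<phi> \<psi>
    unfolding state_metric_def
    by (intro enn2real_mono state_dist_pullback_state_le X F) (use finY that in simp)
  show "state_metric Y (pullback_state Y G \<phi>) (pullback_state Y G \<psi>) \<le> state_metric X \<phi> \<psi>"
    if "\<phi> \<in> states X" "\<psi> \<in> states X" for \<phi> \<psi>
    unfolding state_metric_def
    by (intro enn2real_mono state_dist_pullback_state_le Y G) (use finX that in simp)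
  show "state_metric Y (pullback_state Y G (pullback_state X F \<phi>)) \<phi> \<le> \<epsilon>"
    if "\<phi> \<in> states Y" for \<phi>
    unfolding state_metric_def
    using state_dist_pullback_pullback_le[OF X Y F(1) G(1) FG \<open>\<epsilon> > 0\<close> that] \<open>\<epsilon> > 0\<close>
    by (simp add: enn2real_leI)
  show "state_metric X (pullback_state X F (pullback_state Y G \<psi>)) \<psi> \<le> \<delta>"
    if "\<psi> \<in> states X" for \<psi>
    unfolding state_metric_def
    using state_dist_pullback_pullback_le[OF Y X G(1) F(1) GF \<open>\<delta> > 0\<close> that] \<open>\<delta> > 0\<close>
    by (simp add: enn2real_leI)
qed (use \<open>\<delta> > 0\<close> \<open>\<epsilon> > 0\<close> in auto)

theorem theorem5:
  fixes X :: "'h spectral_triple" and Y :: "nat \<Rightarrow> 'k spectral_triple"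
    and R :: "nat \<Rightarrow> ('h \<Rightarrow> 'h) \<Rightarrow> ('k \<Rightarrow> 'k)"
    and S :: "nat \<Rightarrow> ('k \<Rightarrow> 'k) \<Rightarrow> ('h \<Rightarrow> 'h)"
  assumes "operator_system_spectral_triple X"
    and "\<And>n. operator_system_spectral_triple (Y n)"
    and "metrizes_weak_star X"
    and "\<And>n. metrizes_weak_star (Y n)"
    and "C1_approximate_order_isomorphism Y X R S"
  shows "(\<lambda>n. gromov_hausdorff_distance (states (Y n)) (state_metric (Y n))
                (states X) (state_metric X)) \<longlonglongrightarrow> 0"
proof -
  have iso: "approximate_order_isomorphism Y X R S"
    and maps: "positive_unital X (Y n) (R n)" "C1_contractive X (Y n) (R n)"
      "positive_unital (Y n) X (S n)" "C1_contractive (Y n) X (S n)" for n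
    using assms(5)
    by (simp_all add: C1_approximate_order_isomorphism_def approximate_order_isomorphism_def)
  from iso obtain \<gamma> \<gamma>' :: "nat \<Rightarrow> real"
    where nonneg: "\<forall>n. 0 \<le> \<gamma> n \<and> 0 \<le> \<gamma>' n"
      and lim: "\<gamma> \<longlonglongrightarrow> 0" "\<gamma>' \<longlonglongrightarrow> 0"
      and SR: "\<forall>n. \<forall>a\<in>smooth X. opdist (hilb X) (S n (R n a)) a \<le> ennreal (\<gamma> n) * lip X a"
      and RS: "\<forall>n. \<forall>h\<in>smooth (Y n).
        opdist (hilb (Y n)) (R n (S n h)) h \<le> ennreal (\<gamma>' n) * lip (Y n) h"
    unfolding approximate_order_isomorphism_def by (elim conjE exE)
  \<comment> \<open>The errors may vanish, whereas gluing needs a positive gap; hence the extra \<open>1 / (n + 1)\<close>.\<close>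
  let ?\<delta> = "\<lambda>n. \<gamma> n + inverse (real (Suc n))" and ?\<epsilon> = "\<lambda>n. \<gamma>' n + inverse (real (Suc n))"
  let ?GH = "\<lambda>n. gromov_hausdorff_distance (states (Y n)) (state_metric (Y n))
                (states X) (state_metric X)"
  have bound: "?GH n \<le> ennreal (?\<delta> n + ?\<epsilon> n)" for n
  proof (rule gromov_hausdorff_state_spaces_le[OF assms(1,2,3,4) maps])
    show "opdist (hilb X) (S n (R n a)) a \<le> ennreal (?\<delta> n) * lip X a" if "a \<in> smooth X" for a
      by (rule order_trans[OF SR[rule_format, OF that] mult_right_mono]) (auto intro: ennreal_leI)
    show "opdist (hilb (Y n)) (R n (S n h)) h \<le> ennreal (?\<epsilon> n) * lip (Y n) h"
      if "h \<in> smooth (Y n)" for h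
      by (rule order_trans[OF RS[rule_format, OF that] mult_right_mono]) (auto intro: ennreal_leI)
    show "0 < ?\<delta> n" "0 < ?\<epsilon> n"
      using nonneg by (simp_all add: add_nonneg_pos)
  qed
  have "(\<lambda>n. ?\<delta> n + ?\<epsilon> n) \<longlonglongrightarrow> 0 + 0 + (0 + 0)"
    by (intro tendsto_add lim LIMSEQ_inverse_real_of_nat)
  then have lim_bound: "(\<lambda>n. ennreal (?\<delta> n + ?\<epsilon> n)) \<longlonglongrightarrow> 0"
    using tendsto_ennrealI by fastforce
  show ?thesis
  proof (rule tendsto_sandwich[OF _ _ tendsto_const lim_bound])
    show "\<forall>\<^sub>F n in sequentially. 0 \<le> ?GH n"
      by simp
    show "\<forall>\<^sub>F n in sequentially. ?GH n \<le> ennreal (?\<delta> n + ?\<epsilon> n)"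
      by (intro always_eventually allI bound)
  qed
qed

end
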